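(* Let $m\ge 2$, let $f_1,\dots,f_m\in\mathbb{D}[[x]]$, let $n\in\mathbb{Z}_{\ge-1}^m$ and let $i\ne j$ be indices in $\{1,\dots,m\}$ with $n_i,n_j\ge0$. Whenever the quasideterminants $\rho^i(n)$, $\rho^j(n)$, $\rho^i(n-e_j)$, $\rho^j(n-e_i)$ exist and the last two are invertible, $$\rho^i(n)\,[\rho^i(n-e_j)]^{-1}=-\rho^j(n)\,[\rho^j(n-e_i)]^{-1}.$$
   Context: $\mathbb{D}$ is a (not necessarily commutative) division ring; $f_i(x)=\sum_{j\ge0}f^i_jx^j$, $i=1,\dots,m$, are formal power series with coefficients $f^i_j\in\mathbb{D}$, where $x$ commutes with all elements of $\mathbb{D}$; put $f^i_j=0$ for $j<0$. For $n=(n_1,\dots,n_m)\in\mathbb{Z}_{\ge-1}^m$ write $|n|=n_1+\dots+n_m$; $e_i$ denotes the $i$th standard basis vector of $\mathbb{Z}^m$. Quasideterminant: for a square matrix $X$, let $X^{pq}$ be $X$ with row $p$ and column $q$ deleted. If $X^{pq}$ is invertible, $|X|_{pq}=x_{pq}-r\,(X^{pq})^{-1}c$, where $r$ is row $p$ of $X$ without its $q$th entry and $c$ is column $q$ of $X$ without its $p$th entry (for a $1\times1$ matrix, $|X|_{11}=x_{11}$); the quasideterminant is said to exist when $X^{pq}$ is invertible. When $X$ is invertible and $(X^{-1})_{qp}\ne0$, it equals $((X^{-1})_{qp})^{-1}$. Matrix $\mathcal{M}(n)$: it has $|n|+m-1$ rows, indexed $r=0,\dots,|n|+m-2$, and $|n|+m$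 columns divided into $m$ consecutive blocks; the $i$th block has $n_i+1$ columns indexed $c=0,\dots,n_i$ (empty if $n_i=-1$), and the entry in row $r$ and column $c$ of block $i$ is $f^i_{r-c}$. For $n_i\ge0$, $\rho^i(n)$ is the quasideterminant, with respect to the element in the last row and the last column of the $i$th block, of the square matrix obtained from $\mathcal{M}(n)$ by adding as last row the row $r=|n|+m-1$ given by the same rule (entries $f^l_{|n|+m-1-c}$, $c=0,\dots,n_l$, in block $l$). *)

theory Defs
  imports
    "HOL-Computational_Algebra.Formal_Power_Series"
    "Jordan_Normal_Form.Determinant"
begin

text \<open>The carrier of all matrices is a division ring that need not be commutative. Only the
  ring-theoretic part of the matrix library is used: \<^const>\<open>mat_delete\<close>, \<^const>\<open>invertible_mat\<close>
  (existence of a two-sided inverse) and the products, in which the entries of the left factor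
  are multiplied from the left.\<close>

definition mat_inv :: "'a::semiring_1 mat \<Rightarrow> 'a mat" where
  "mat_inv A = (THE B. inverts_mat A B \<and> inverts_mat B A)"

lemma mat_inv_eqI:
  fixes A :: "'a::semiring_1 mat"
  assumes A: "A \<in> carrier_mat k k" and AB: "inverts_mat A B" and BA: "inverts_mat B A"
  shows "mat_inv A = B" and "B \<in> carrier_mat k k"
proof -
  have carr: "C \<in> carrier_mat k k" if "inverts_mat A C" "inverts_mat C A" for C
  proof
    have "dim_col (A * C) = dim_col (1\<^sub>m (dim_row A) :: 'a mat)"
      using that(1) by (simp only: inverts_mat_def)
    then show "dim_col C = k" using A by simp
    have "dim_col (C * A) = dim_col (1\<^sub>m (dim_row C) :: 'a mat)"
      using that(2) by (simp only: inverts_mat_def)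
    then show "dim_row C = k" using A by simp
  qed
  show B: "B \<in> carrier_mat k k" using carr AB BA .
  show "mat_inv A = B"
    unfolding mat_inv_def
  proof (rule the_equality)
    show "inverts_mat A B \<and> inverts_mat B A" using AB BA by simp
    fix C assume C: "inverts_mat A C \<and> inverts_mat C A"
    then have Cc: "C \<in> carrier_mat k k" using carr by blast
    have "C = C * (A * B)"
      using AB A Cc by (simp add: inverts_mat_def)
    also have "\<dots> = (C * A) * B"
      using assoc_mult_mat[OF Cc A B] by simp
    also have "\<dots> = B" using C Cc B by (simp add: inverts_mat_def)
    finally show "C = B" .
  qed
qed

text \<open>Row and column indices are 0-based, as in the matrix library. For a 1 by 1 matrix the
  deleted matrix is the 0 by 0 matrix, which is invertible, so the quasideterminant exists and is
  the entry itself.\<close>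

definition quasidet_exists :: "'a::ring_1 mat \<Rightarrow> nat \<Rightarrow> nat \<Rightarrow> bool" where
  "quasidet_exists X p q \<longleftrightarrow>
     square_mat X \<and> p < dim_row X \<and> q < dim_col X \<and> invertible_mat (mat_delete X p q)"

definition quasidet :: "'a::ring_1 mat \<Rightarrow> nat \<Rightarrow> nat \<Rightarrow> 'a" where
  "quasidet X p q =
     X $$ (p, q) -
       vec (dim_col X - 1) (\<lambda>k. X $$ (p, insert_index q k)) \<bullet>
         (mat_inv (mat_delete X p q) *\<^sub>v vec (dim_row X - 1) (\<lambda>k. X $$ (insert_index p k, q)))"

definition fps_coeff_int :: "'a::zero fps \<Rightarrow> int \<Rightarrow> 'a" where
  "fps_coeff_int g k = (if k < 0 then 0 else fps_nth g (nat k))"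

text \<open>The series \<open>f i\<close> and the components \<open>n i\<close> matter only for \<open>i\<close> between \<open>1\<close> and \<open>m\<close>.
  The columns of the matrices are listed as pairs of a block \<open>i\<close> and an index \<open>c\<close> between \<open>0\<close>
  and \<open>n i\<close>; block \<open>i\<close> is empty when \<open>n i = -1\<close>.\<close>

definition block_columns :: "nat \<Rightarrow> (nat \<Rightarrow> int) \<Rightarrow> (nat \<times> nat) list" where
  "block_columns m n = concat (map (\<lambda>i. map (Pair i) [0..<nat (n i + 1)]) [1..<Suc m])"

definition num_columns :: "nat \<Rightarrow> (nat \<Rightarrow> int) \<Rightarrow> nat" where
  "num_columns m n = nat ((\<Sum>i = 1..m. n i) + int m)"

text \<open>The position of the last column of block \<open>i\<close>, meaningful only for \<open>n i \<ge> 0\<close>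
  (see \<open>nth_block_last_column\<close> below).\<close>

definition block_last_column :: "(nat \<Rightarrow> int) \<Rightarrow> nat \<Rightarrow> nat" where
  "block_last_column n i = nat ((\<Sum>l = 1..i. n l + 1) - 1)"

text \<open>Rows \<open>0, \<dots>, R - 1\<close> of the infinite matrix whose entry in row \<open>r\<close> and column \<open>c\<close> of
  block \<open>i\<close> is the coefficient of index \<open>r - c\<close> of \<open>f i\<close>.\<close>

definition block_rows ::
  "(nat \<Rightarrow> 'a::zero fps) \<Rightarrow> nat \<Rightarrow> (nat \<Rightarrow> int) \<Rightarrow> nat \<Rightarrow> 'a mat" where
  "block_rows f m n R =
     mat R (num_columns m n)
       (\<lambda>(r, k). case block_columns m n ! k of (i, c) \<Rightarrow> fps_coeff_int (f i) (int r - int c))"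

definition M_mat :: "(nat \<Rightarrow> 'a::zero fps) \<Rightarrow> nat \<Rightarrow> (nat \<Rightarrow> int) \<Rightarrow> 'a mat" where
  "M_mat f m n = block_rows f m n (num_columns m n - 1)"

text \<open>\<^const>\<open>M_mat\<close> with the next row, of index \<open>num_columns m n - 1\<close>, added at the bottom
  (see \<open>M_mat_conv_M_ext\<close> below).\<close>

definition M_ext :: "(nat \<Rightarrow> 'a::zero fps) \<Rightarrow> nat \<Rightarrow> (nat \<Rightarrow> int) \<Rightarrow> 'a mat" where
  "M_ext f m n = block_rows f m n (num_columns m n)"

definition rho_exists ::
  "(nat \<Rightarrow> 'a::division_ring fps) \<Rightarrow> nat \<Rightarrow> nat \<Rightarrow> (nat \<Rightarrow> int) \<Rightarrow> bool" where
  "rho_exists f m i n \<longleftrightarrow>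
     quasidet_exists (M_ext f m n) (num_columns m n - 1) (block_last_column n i)"

definition rho ::
  "(nat \<Rightarrow> 'a::division_ring fps) \<Rightarrow> nat \<Rightarrow> nat \<Rightarrow> (nat \<Rightarrow> int) \<Rightarrow> 'a" where
  "rho f m i n = quasidet (M_ext f m n) (num_columns m n - 1) (block_last_column n i)"

lemma M_mat_conv_M_ext:
  "M_mat f m n = mat (num_columns m n - 1) (num_columns m n) (\<lambda>(r, k). M_ext f m n $$ (r, k))"
  by (rule eq_matI) (auto simp: M_mat_def M_ext_def block_rows_def)

lemma length_block_columns_aux:
  assumes "\<forall>l\<in>{1..m}. n l \<ge> -1"
  shows "int (length (block_columns m n)) = (\<Sum>l = 1..m. n l + 1)"
  using assms
proof (induction m)
  case 0
  then show ?case by (simp add: block_columns_def)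
next
  case (Suc m)
  have "n (Suc m) \<ge> -1" using Suc.prems by simp
  moreover have "int (length (block_columns m n)) = (\<Sum>l = 1..m. n l + 1)"
    using Suc.prems by (intro Suc.IH) simp
  ultimately show ?case by (simp add: block_columns_def)
qed

lemma length_block_columns:
  assumes "\<forall>l\<in>{1..m}. n l \<ge> -1"
  shows "length (block_columns m n) = num_columns m n"
  using length_block_columns_aux[OF assms] by (simp add: num_columns_def sum.distrib)

lemma nth_block_last_column:
  assumes n: "\<forall>l\<in>{1..m}. n l \<ge> -1" and i: "i \<in> {1..m}" and ni: "n i \<ge> 0"
  shows "block_last_column n i < num_columns m n"
    and "block_columns m n ! block_last_column n i = (i, nat (n i))"
proof -
  obtain k where k: "i = Suc k" using i by (cases i) auto
  let ?B = "\<lambda>i. map (Pair i) [0..<nat (n i + 1)]"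
  have "[1..<Suc m] = [1..<Suc k] @ i # [Suc i..<Suc m]"
    using i k upt_add_eq_append[of 1 "Suc k" "m - k"] upt_conv_Cons[of "Suc k" "Suc m"] by simp
  then have split: "block_columns m n =
      block_columns k n @ ?B i @ concat (map ?B [Suc i..<Suc m])"
    by (simp add: block_columns_def)
  have len: "int (length (block_columns k n)) = (\<Sum>l = 1..k. n l + 1)"
    using n i k by (intro length_block_columns_aux) auto
  then have last: "block_last_column n i = length (block_columns k n) + nat (n i)"
    using ni by (auto simp: block_last_column_def k)
  show "block_last_column n i < num_columns m n"
    using ni by (simp add: length_block_columns[OF n, symmetric] split last)
  show "block_columns m n ! block_last_column n i = (i, nat (n i))"
    using ni by (simp add: split last nth_append del: upt_Suc)
qed

end

theory Submission
  imports Defs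
begin

text \<open>Existence of the quasideterminant \<open>\<rho>\<^sup>i(n)\<close> means that the columns of \<open>M(n)\<close> other than the last
  one of block \<open>i\<close> form an invertible matrix. So the right kernel of \<open>M(n)\<close> is the line spanned by a
  vector whose coordinate at that column is 1, and on a kernel vector \<open>z\<close> the additional row takes the
  value \<open>\<rho>\<^sup>i(n) z\<^sub>i\<close>, where \<open>z\<^sub>i\<close> is the coordinate at the last column of block \<open>i\<close>.
  The kernel vectors belonging to \<open>n - e\<^sub>j\<close> and to \<open>n - e\<^sub>i\<close>, extended by 0, are mapped by the last row
  of \<open>M(n)\<close> to \<open>s = \<rho>\<^sup>i(n - e\<^sub>j)\<close> and \<open>t = \<rho>\<^sup>j(n - e\<^sub>i)\<close>. If \<open>u\<close> and \<open>v\<close> are these vectors, then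
  \<open>u s\<^sup>-\<^sup>1 - v t\<^sup>-\<^sup>1\<close> lies in the kernel of \<open>M(n)\<close>, and its coordinates at the last columns of the blocks
  \<open>i\<close> and \<open>j\<close> are \<open>s\<^sup>-\<^sup>1\<close> and \<open>- t\<^sup>-\<^sup>1\<close>. Evaluating the additional row in both ways gives the identity.\<close>

section \<open>Quasideterminants and kernel vectors of a square matrix\<close>

lemma sum_insert_index:
  fixes g :: "nat \<Rightarrow> 'a::comm_monoid_add"
  assumes "q < Suc k"
  shows "(\<Sum>l = 0..<Suc k. g l) = g q + (\<Sum>l = 0..<k. g (insert_index q l))"
proof -
  have "(\<Sum>l = 0..<k. g (insert_index q l)) = (\<Sum>l \<in> {0..<Suc k} - {q}. g l)"
    using sum.reindex[OF insert_index_inj_on, of g q "{0..<k}"] by (simp add: insert_index_image[OF assms])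
  moreover have "(\<Sum>l = 0..<Suc k. g l) = g q + (\<Sum>l \<in> {0..<Suc k} - {q}. g l)"
    by (rule sum.remove) (use assms in auto)
  ultimately show ?thesis by simp
qed

context
  fixes X :: "'a::ring_1 mat" and p q k :: nat and w :: "'a vec"
  assumes X: "X \<in> carrier_mat (Suc k) (Suc k)" and ex: "quasidet_exists X p q"
  defines "w \<equiv> mat_inv (mat_delete X p q) *\<^sub>v vec k (\<lambda>l. X $$ (insert_index p l, q))"
begin

lemma pivot_less: "p < Suc k" "q < Suc k"
  using X ex by (auto simp: quasidet_exists_def)

text \<open>Apart from row \<open>p\<close>, the equations read
  \<open>A *\<^sub>v y + d = 0\<^sub>v k\<close> with the invertible deleted matrix
  \<open>A\<close>; multiplying by its inverse solves them for \<open>y\<close>. Up to sign,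
  \<open>w\<close> is thus the part away from \<open>q\<close> of the kernel vector with coordinate
  1 at \<open>q\<close>. Scalars such as \<open>z q\<close> stay on the right, since row equations
  are respected by right multiples only.\<close>

lemma kernel_iff:
  "(\<forall>r<Suc k. r \<noteq> p \<longrightarrow> (\<Sum>l = 0..<Suc k. X $$ (r, l) * z l) = 0) \<longleftrightarrow>
   (\<forall>l<k. z (insert_index q l) = - (w $ l * z q))"
proof -
  define A where "A = mat_delete X p q"
  define B where "B = mat_inv A"
  define y where "y = vec k (\<lambda>l. z (insert_index q l))"
  define d where "d = vec k (\<lambda>l. X $$ (insert_index p l, q) * z q)"
  have A: "A \<in> carrier_mat k k"
    unfolding A_def by (intro carrier_matI) (use X in \<open>auto simp: mat_delete_def\<close>)
  have "invertible_mat A"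
    using ex by (simp add: quasidet_exists_def A_def)
  then obtain B' where B': "inverts_mat A B'" "inverts_mat B' A"
    unfolding invertible_mat_def by blast
  have "B = B'" and B: "B \<in> carrier_mat k k"
    using mat_inv_eqI[OF A B'] by (simp_all add: B_def)
  with B' A have AB: "A * B = 1\<^sub>m k" and BA: "B * A = 1\<^sub>m k"
    by (simp_all add: inverts_mat_def)
  have inv: "B *\<^sub>v (A *\<^sub>v x) = x" "A *\<^sub>v (B *\<^sub>v x) = x" if "x \<in> carrier_vec k" for x
    using assoc_mult_mat_vec[OF A B that] assoc_mult_mat_vec[OF B A that] that by (simp_all add: AB BA)
  have zero: "C *\<^sub>v 0\<^sub>v k = 0\<^sub>v k" if "C \<in> carrier_mat k k" for C :: "'a mat"
    using that by (intro eq_vecI) (auto simp: scalar_prod_def)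
  have y: "y \<in> carrier_vec k" and d: "d \<in> carrier_vec k"
    by (auto simp: y_def d_def)
  have row: "(\<Sum>l = 0..<Suc k. X $$ (insert_index p r, l) * z l) = (A *\<^sub>v y + d) $ r" if "r < k" for r
    using that A X pivot_less
    by (subst sum_insert_index[OF pivot_less(2)])
      (auto simp: mult_mat_vec_def scalar_prod_def y_def d_def A_def mat_delete_index add.commute intro!: sum.cong)
  have w: "(B *\<^sub>v d) $ l = w $ l * z q" if "l < k" for l
    using that B
    by (auto simp: w_def A_def[symmetric] B_def[symmetric] mult_mat_vec_def scalar_prod_def d_def
        sum_distrib_right mult.assoc intro!: sum.cong)
  have "(\<forall>r<Suc k. r \<noteq> p \<longrightarrow> (\<Sum>l = 0..<Suc k. X $$ (r, l) * z l) = 0) \<longleftrightarrow>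
      (\<forall>r \<in> insert_index p ` {0..<k}. (\<Sum>l = 0..<Suc k. X $$ (r, l) * z l) = 0)"
    unfolding insert_index_image[OF pivot_less(1)] by auto
  also have "\<dots> \<longleftrightarrow> (\<forall>r<k. (\<Sum>l = 0..<Suc k. X $$ (insert_index p r, l) * z l) = 0)"
    by auto
  also have "\<dots> \<longleftrightarrow> A *\<^sub>v y + d = 0\<^sub>v k"
  proof -
    have "dim_vec (A *\<^sub>v y + d) = k" using d by simp
    then have "A *\<^sub>v y + d = 0\<^sub>v k \<longleftrightarrow> (\<forall>r<k. (A *\<^sub>v y + d) $ r = 0)"
      by (metis eq_vecI index_zero_vec)
    then show ?thesis by (simp only: row cong: imp_cong)
  qed
  also have "\<dots> \<longleftrightarrow> y + B *\<^sub>v d = 0\<^sub>v k"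
  proof
    assume eq: "A *\<^sub>v y + d = 0\<^sub>v k"
    have "y + B *\<^sub>v d = B *\<^sub>v (A *\<^sub>v y + d)"
      using A B y d inv(1)[OF y] by (simp add: mult_add_distrib_mat_vec[of B k k])
    then show "y + B *\<^sub>v d = 0\<^sub>v k" by (simp add: eq zero[OF B])
  next
    assume eq: "y + B *\<^sub>v d = 0\<^sub>v k"
    have "A *\<^sub>v y + d = A *\<^sub>v (y + B *\<^sub>v d)"
      using A B y d inv(2)[OF d] by (simp add: mult_add_distrib_mat_vec[of A k k])
    then show "A *\<^sub>v y + d = 0\<^sub>v k" by (simp add: eq zero[OF A])
  qed
  also have "\<dots> \<longleftrightarrow> (\<forall>l<k. z (insert_index q l) = - (w $ l * z q))"
    using B by (simp add: vec_eq_iff y_def w eq_neg_iff_add_eq_0 del: index_mult_mat_vec)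
  finally show ?thesis .
qed

text \<open>After the solved coordinates are substituted into row \<open>p\<close>, the factor
  \<open>z q\<close> comes out on the right and the definition of the quasideterminant
  remains.\<close>

lemma quasidet_kernel_vector:
  assumes "\<forall>r<Suc k. r \<noteq> p \<longrightarrow> (\<Sum>l = 0..<Suc k. X $$ (r, l) * z l) = 0"
  shows "(\<Sum>l = 0..<Suc k. X $$ (p, l) * z l) = quasidet X p q * z q"
proof -
  have z: "z (insert_index q l) = - (w $ l * z q)" if "l < k" for l
    using assms that unfolding kernel_iff by blast
  \<comment> \<open>The range of summation in a scalar product is the dimension of its right
    factor.\<close>
  have [simp]: "dim_vec w = k"
    using mat_inv_eqI(2)[of "mat_delete X p q" k] mat_inv_eqI(1)[of "mat_delete X p q" k] ex X
    by (auto simp: quasidet_exists_def invertible_mat_def w_def mat_delete_def)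
  have "(\<Sum>l = 0..<Suc k. X $$ (p, l) * z l) =
      X $$ (p, q) * z q + (\<Sum>l = 0..<k. X $$ (p, insert_index q l) * z (insert_index q l))"
    by (rule sum_insert_index[OF pivot_less(2)])
  also have "\<dots> = quasidet X p q * z q"
    using X by (simp add: quasidet_def w_def[symmetric] scalar_prod_def z sum_negf sum_distrib_right mult.assoc
        left_diff_distrib)
  finally show ?thesis .
qed

lemma obtain_kernel_vector:
  obtains z where "z q = 1"
    and "\<forall>r<Suc k. r \<noteq> p \<longrightarrow> (\<Sum>l = 0..<Suc k. X $$ (r, l) * z l) = 0"
proof -
  \<comment> \<open>\<open>delete_index q\<close> undoes \<open>insert_index q\<close>, so this is
    the solution in \<open>kernel_iff\<close> with \<open>z q = 1\<close>.\<close>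
  define z where "z l = (if l = q then 1 else - (w $ delete_index q l))" for l
  have "z q = 1" "\<forall>l<k. z (insert_index q l) = - (w $ l * z q)"
    by (auto simp: z_def)
  then show thesis using that unfolding kernel_iff by blast
qed

end

section \<open>Columns named by block and index\<close>

definition column_set :: "nat \<Rightarrow> (nat \<Rightarrow> int) \<Rightarrow> (nat \<times> nat) set" where
  "column_set m n = (SIGMA i:{1..m}. {0..<nat (n i + 1)})"

lemma set_block_columns: "set (block_columns m n) = column_set m n"
proof -
  have "{1..<Suc m} = {1..m}" by auto
  then show ?thesis
    by (auto simp: block_columns_def column_set_def image_iff simp del: upt_Suc)
qed

lemma distinct_block_columns: "distinct (block_columns m n)"
proof (induction m)
  case (Suc m)
  have "block_columns (Suc m) n = block_columns m n @ map (Pair (Suc m)) [0..<nat (n (Suc m) + 1)]"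
    by (simp add: block_columns_def)
  then show ?case
    using Suc by (auto simp: set_block_columns distinct_map inj_on_def column_set_def)
qed (simp add: block_columns_def)

lemma finite_column_set: "finite (column_set m n)"
  by (simp flip: set_block_columns)

text \<open>At a labelled column the entry does not depend on \<open>n\<close>. Lowering a component
  of \<open>n\<close> then merely drops a label, whereas positions of later columns would
  shift.\<close>

definition column_entry :: "(nat \<Rightarrow> 'a::zero fps) \<Rightarrow> nat \<Rightarrow> nat \<times> nat \<Rightarrow> 'a" where
  "column_entry f r = (\<lambda>(i, c). fps_coeff_int (f i) (int r - int c))"

context
  fixes m :: nat and n :: "nat \<Rightarrow> int"
  assumes n: "\<forall>l\<in>{1..m}. n l \<ge> -1"
begin

lemma sum_column_set:
  "(\<Sum>x\<in>column_set m n. h x) = (\<Sum>l = 0..<num_columns m n. h (block_columns m n ! l))"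
proof -
  have "(\<Sum>x\<in>column_set m n. h x) = sum_list (map h (block_columns m n))"
    by (simp add: sum_list_distinct_conv_sum_set distinct_block_columns set_block_columns)
  then show ?thesis by (simp add: sum_list_sum_nth length_block_columns[OF n])
qed

lemma M_ext_row:
  fixes f :: "nat \<Rightarrow> 'a::semiring_0 fps"
  assumes "r < num_columns m n"
  shows "(\<Sum>x\<in>column_set m n. column_entry f r x * h x) =
    (\<Sum>l = 0..<num_columns m n. M_ext f m n $$ (r, l) * h (block_columns m n ! l))"
  using assms by (auto simp: sum_column_set M_ext_def block_rows_def column_entry_def intro!: sum.cong)

context
  fixes f :: "nat \<Rightarrow> 'a::division_ring fps" and i :: nat
  assumes i: "i \<in> {1..m}" and ni: "n i \<ge> 0" and ex: "rho_exists f m i n"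
begin

lemma num_columns_Suc: "num_columns m n = Suc (num_columns m n - 1)"
  using nth_block_last_column(1)[OF n i ni] by simp

lemma M_ext_carrier:
  "M_ext f m n \<in> carrier_mat (Suc (num_columns m n - 1)) (Suc (num_columns m n - 1))"
  using num_columns_Suc by (simp add: M_ext_def block_rows_def)

lemma rho_kernel_vector:
  assumes "\<And>r. r < num_columns m n - 1 \<Longrightarrow> (\<Sum>x\<in>column_set m n. column_entry f r x * z x) = 0"
  shows "(\<Sum>x\<in>column_set m n. column_entry f (num_columns m n - 1) x * z x) =
    rho f m i n * z (i, nat (n i))"
proof -
  let ?N = "num_columns m n" and ?z = "\<lambda>l. z (block_columns m n ! l)"
  have "\<forall>r<?N. r \<noteq> ?N - 1 \<longrightarrow> (\<Sum>l = 0..<?N. M_ext f m n $$ (r, l) * ?z l) = 0"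
  proof (intro allI impI)
    fix r assume "r < ?N" "r \<noteq> ?N - 1"
    then show "(\<Sum>l = 0..<?N. M_ext f m n $$ (r, l) * ?z l) = 0"
      using assms[of r] by (simp add: M_ext_row)
  qed
  from quasidet_kernel_vector[OF M_ext_carrier ex[unfolded rho_exists_def], folded num_columns_Suc, OF this]
  show ?thesis
    using num_columns_Suc by (simp add: M_ext_row rho_def nth_block_last_column(2)[OF n i ni])
qed

lemma obtain_rho_kernel_vector:
  obtains z where "z (i, nat (n i)) = 1"
    and "\<And>r. r < num_columns m n - 1 \<Longrightarrow> (\<Sum>x\<in>column_set m n. column_entry f r x * z x) = 0"
    and "(\<Sum>x\<in>column_set m n. column_entry f (num_columns m n - 1) x * z x) = rho f m i n"
proof -
  let ?N = "num_columns m n" and ?L = "block_columns m n"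
  obtain y where y: "y (block_last_column n i) = 1"
      "\<forall>r<?N. r \<noteq> ?N - 1 \<longrightarrow> (\<Sum>l = 0..<?N. M_ext f m n $$ (r, l) * y l) = 0"
    using obtain_kernel_vector[OF M_ext_carrier ex[unfolded rho_exists_def], folded num_columns_Suc] .
  have "inj_on (\<lambda>l. ?L ! l) {0..<?N}"
    using distinct_block_columns[of m n]
    by (simp add: length_block_columns[OF n] inj_on_def nth_eq_iff_index_eq)
  then have inv: "the_inv_into {0..<?N} ((!) ?L) (?L ! l) = l" if "l < ?N" for l
    using that by (simp add: the_inv_into_f_f)
  \<comment> \<open>The labels are distinct, so coordinates given by position can be transported to
    labels.\<close>
  define z where "z = y \<circ> the_inv_into {0..<?N} ((!) ?L)"
  have z: "z (?L ! l) = y l" if "l < ?N" for l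
    using inv[OF that] by (simp add: z_def)
  have 1: "z (i, nat (n i)) = 1"
    using z[OF nth_block_last_column(1)[OF n i ni]] nth_block_last_column(2)[OF n i ni] y(1) by simp
  have 2: "(\<Sum>x\<in>column_set m n. column_entry f r x * z x) = 0" if "r < ?N - 1" for r
    using y(2) that by (simp add: M_ext_row z)
  from that[OF 1 2] rho_kernel_vector[of z, OF 2] 1 show thesis by simp
qed

end

end

section \<open>Lowering one component of \<open>n\<close>\<close>

lemma column_set_decr:
  assumes "j \<in> {1..m}" "n j \<ge> 0"
  shows "column_set m n = insert (j, nat (n j)) (column_set m (n(j := n j - 1)))"
    and "(j, nat (n j)) \<notin> column_set m (n(j := n j - 1))"
  using assms by (auto simp: column_set_def split: if_splits)

lemma num_columns_decr:
  assumes "j \<in> {1..m}"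
  shows "num_columns m (n(j := n j - 1)) = num_columns m n - 1"
proof -
  have "(\<Sum>l = 1..m. (n(j := n j - 1)) l) = (\<Sum>l = 1..m. n l) - 1"
    using sum.remove[OF _ assms, of "n(j := n j - 1)"] sum.remove[OF _ assms, of n]
    by (simp cong: sum.cong_simp)
  then show ?thesis by (simp add: num_columns_def)
qed

lemma sum_column_set_decr:
  fixes h :: "nat \<times> nat \<Rightarrow> 'a::semiring_0"
  assumes "j \<in> {1..m}" "n j \<ge> 0"
  shows "(\<Sum>x\<in>column_set m n. h x * (u((j, nat (n j)) := 0)) x) =
    (\<Sum>x\<in>column_set m (n(j := n j - 1)). h x * u x)"
proof -
  let ?S = "column_set m (n(j := n j - 1))"
  have "(\<Sum>x\<in>column_set m n. h x * (u((j, nat (n j)) := 0)) x) =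
      (\<Sum>x\<in>?S. h x * (u((j, nat (n j)) := 0)) x)"
    using column_set_decr(2)[of j m n, OF assms]
    by (subst column_set_decr(1)[of j m n, OF assms]) (simp add: finite_column_set)
  also have "\<dots> = (\<Sum>x\<in>?S. h x * u x)"
    using column_set_decr(2)[of j m n, OF assms] by (intro sum.cong) auto
  finally show ?thesis .
qed

theorem proposition3p1:
  fixes f :: "nat \<Rightarrow> 'a::division_ring fps"
    and m i j :: nat
    and n :: "nat \<Rightarrow> int"
  assumes "m \<ge> 2"
    and "\<forall>l\<in>{1..m}. n l \<ge> -1"
    and "i \<in> {1..m}" and "j \<in> {1..m}" and "i \<noteq> j"
    and "n i \<ge> 0" and "n j \<ge> 0"
    and "rho_exists f m i n"
    and "rho_exists f m j n"
    and "rho_exists f m i (n(j := n j - 1))"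
    and "rho_exists f m j (n(i := n i - 1))"
    and "rho f m i (n(j := n j - 1)) \<noteq> 0"
    and "rho f m j (n(i := n i - 1)) \<noteq> 0"
  shows "rho f m i n * inverse (rho f m i (n(j := n j - 1))) =
         - (rho f m j n * inverse (rho f m j (n(i := n i - 1))))"
proof -
  let ?s = "rho f m i (n(j := n j - 1))" and ?t = "rho f m j (n(i := n i - 1))"
  let ?S = "column_set m n" and ?N = "num_columns m n"
  let ?a = "(i, nat (n i))" and ?b = "(j, nat (n j))"
  \<comment> \<open>The extended matrix for the lowered vector has \<open>?N - 1\<close> rows, so
    its added row has index \<open>?N - 2\<close>, that of the last row of
    \<open>M_mat f m n\<close>.\<close>
  have kernel: "\<exists>u. u (k, nat (n k)) = 1 \<and> u (l, nat (n l)) = 0 \<and>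
      (\<forall>r < ?N - 2. (\<Sum>x\<in>?S. column_entry f r x * u x) = 0) \<and>
      (\<Sum>x\<in>?S. column_entry f (?N - 2) x * u x) = rho f m k (n(l := n l - 1))"
    if kl: "k \<in> {1..m}" "l \<in> {1..m}" "k \<noteq> l" "n k \<ge> 0" "n l \<ge> 0"
      and ex: "rho_exists f m k (n(l := n l - 1))" for k l
  proof -
    let ?n' = "n(l := n l - 1)"
    have "\<forall>h\<in>{1..m}. ?n' h \<ge> -1" "?n' k \<ge> 0"
      using assms(2) kl by auto
    then obtain z where "z (k, nat (?n' k)) = 1"
      and "\<And>r. r < num_columns m ?n' - 1 \<Longrightarrow> (\<Sum>x\<in>column_set m ?n'. column_entry f r x * z x) = 0"
      and "(\<Sum>x\<in>column_set m ?n'. column_entry f (num_columns m ?n' - 1) x * z x) = rho f m k ?n'"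
      by (rule obtain_rho_kernel_vector[OF _ kl(1) _ ex]) blast
    then show ?thesis
      using kl num_columns_decr[OF kl(2), of n]
      by (intro exI[of _ "z((l, nat (n l)) := 0)"])
        (simp only: sum_column_set_decr[of l m n, OF kl(2,5)], simp add: numeral_2_eq_2)
  qed
  obtain u where u: "u ?a = 1" "u ?b = 0"
    "\<And>r. r < ?N - 2 \<Longrightarrow> (\<Sum>x\<in>?S. column_entry f r x * u x) = 0"
    "(\<Sum>x\<in>?S. column_entry f (?N - 2) x * u x) = ?s"
    using kernel[of i j] assms by blast
  obtain v where v: "v ?b = 1" "v ?a = 0"
    "\<And>r. r < ?N - 2 \<Longrightarrow> (\<Sum>x\<in>?S. column_entry f r x * v x) = 0"
    "(\<Sum>x\<in>?S. column_entry f (?N - 2) x * v x) = ?t"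
    using kernel[of j i] assms by blast
  \<comment> \<open>The right factors normalize both values in row \<open>?N - 2\<close> to 1, so
    that they cancel.\<close>
  define z where "z x = u x * inverse ?s - v x * inverse ?t" for x
  have row: "(\<Sum>x\<in>?S. column_entry f r x * z x) =
      (\<Sum>x\<in>?S. column_entry f r x * u x) * inverse ?s - (\<Sum>x\<in>?S. column_entry f r x * v x) * inverse ?t" for r
    by (simp add: z_def right_diff_distrib sum_subtractf sum_distrib_right mult.assoc)
  have ker: "(\<Sum>x\<in>?S. column_entry f r x * z x) = 0" if "r < ?N - 1" for r
  proof (cases "r < ?N - 2")
    case True
    then show ?thesis by (simp add: row u v)
  next
    case False
    with that have "r = ?N - 2" by simp
    then show ?thesis using assms(12,13) by (simp add: row u v)
  qed
  \<comment> \<open>Both sides are the value of row \<open>?N - 1\<close> on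
    \<open>z\<close>.\<close>
  have "rho f m i n * z ?a = rho f m j n * z ?b"
    using rho_kernel_vector[OF assms(2,3,6,8) ker] rho_kernel_vector[OF assms(2,4,7,9) ker] by simp
  then show ?thesis by (simp add: z_def u v)
qed

end
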